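(* Let $X$ be a Banach space (over the real or complex scalars) satisfying the weak Namioka-Phelps property. Then the norm on $X$ is strongly subdifferentiable (SSD) at every unit vector of $X$.
   Context: For a Banach space $X$, let $X_1$ be its closed unit ball, $S_X$ its unit sphere, and $X^\ast$ its dual. Weak Namioka-Phelps property: $X$ has this property if every norm-attaining functional $x^\ast \in S_{X^\ast}$ (i.e. $x^\ast(x)=1$ for some $x\in S_X$) is a point of weak$^\ast$-norm continuity for the identity map on $S_{X^\ast}$; that is, the identity map from $S_{X^\ast}$ with the weak$^\ast$ topology to $S_{X^\ast}$ with the norm topology is continuous at $x^\ast$. SSD: the norm of $X$ is strongly subdifferentiable at $x\in S_X$ if the limit $\lim_{t\to 0^+}\frac{\|x+ty\|-\|x\|}{t}$ exists uniformly for $y\in X_1$. *)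

theory Defs
  imports "HOL-Analysis.Analysis"
begin

text \<open>
  The scalar multiplication is an explicit parameter over a scalar field \<open>'k\<close>, used below for
  real and complex scalars, because the libraries provide type classes for real normed spaces only.
  On a complex normed space it has to extend the real scalar multiplication of the type class.
\<close>

locale normed_space_over = vector_space smul
  for smul :: "'k::real_normed_field \<Rightarrow> 'a::real_normed_vector \<Rightarrow> 'a" +
  assumes smul_of_real: "smul (of_real r) x = r *\<^sub>R x"
    and norm_smul: "norm (smul c x) = norm c * norm x"

lemma normed_space_over_scaleR:
  "normed_space_over (scaleR :: real \<Rightarrow> 'a::real_normed_vector \<Rightarrow> 'a)"
  by unfold_locales (auto simp: algebra_simps)

lemma normed_space_over_times:
  "normed_space_over ((*) :: 'k::real_normed_field \<Rightarrow> 'k \<Rightarrow> 'k)"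
  by unfold_locales (auto simp: algebra_simps norm_mult scaleR_conv_of_real)

text \<open>
  The type \<open>'a \<Rightarrow>\<^sub>L 'k\<close> consists of the bounded real-linear maps, with the operator
  norm; the dual is the set of those that are linear over \<open>'k\<close>.
\<close>

definition dual_space ::
    "('k::real_normed_field \<Rightarrow> 'a::real_normed_vector \<Rightarrow> 'a) \<Rightarrow> ('a \<Rightarrow>\<^sub>L 'k) set" where
  "dual_space smul = {f. Vector_Spaces.linear smul (*) (blinfun_apply f)}"

lemma dual_space_scaleR:
  "dual_space (scaleR :: real \<Rightarrow> 'a::real_normed_vector \<Rightarrow> 'a) = UNIV"
proof -
  have "Vector_Spaces.linear scaleR (*) (blinfun_apply f)" for f :: "'a \<Rightarrow>\<^sub>L real"
    using bounded_linear.linear[OF blinfun.bounded_linear_right[of f]]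
    by (simp add: linear_def real_scaleR_def[abs_def])
  then show ?thesis by (auto simp: dual_space_def)
qed

definition dual_sphere ::
    "('k::real_normed_field \<Rightarrow> 'a::real_normed_vector \<Rightarrow> 'a) \<Rightarrow> ('a \<Rightarrow>\<^sub>L 'k) set" where
  "dual_sphere smul = {f \<in> dual_space smul. norm f = 1}"

text \<open>
  The Euclidean topology on the function type \<open>'a \<Rightarrow> 'k\<close> is the topology of pointwise
  convergence.
\<close>

definition weak_star_topology ::
    "('k::real_normed_field \<Rightarrow> 'a::real_normed_vector \<Rightarrow> 'a) \<Rightarrow> ('a \<Rightarrow>\<^sub>L 'k) topology" where
  "weak_star_topology smul = pullback_topology (dual_space smul) blinfun_apply euclidean"

definition norm_attaining :: "('a::real_normed_vector \<Rightarrow>\<^sub>L 'k::real_normed_field) \<Rightarrow> bool" where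
  "norm_attaining f \<longleftrightarrow> (\<exists>x. norm x = 1 \<and> blinfun_apply f x = 1)"

definition weak_namioka_phelps ::
    "('k::real_normed_field \<Rightarrow> 'a::real_normed_vector \<Rightarrow> 'a) \<Rightarrow> bool" where
  "weak_namioka_phelps smul \<longleftrightarrow>
     (\<forall>f \<in> dual_sphere smul. norm_attaining f \<longrightarrow>
        topcontinuous_at
          (subtopology (weak_star_topology smul) (dual_sphere smul))
          (top_of_set (dual_sphere smul)) (\<lambda>g. g) f)"

definition strongly_subdifferentiable_at :: "'a::real_normed_vector \<Rightarrow> bool" where
  "strongly_subdifferentiable_at x \<longleftrightarrow>
     (\<exists>l. uniform_limit (cball 0 1) (\<lambda>t y. (norm (x + t *\<^sub>R y) - norm x) / t) l (at_right 0))"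

end

theory Submission
  imports Defs
begin

text \<open>
  Let \<open>F\<close> be the set of norm-one functionals with value \<open>1\<close> at the unit vector \<open>x\<close>. By weak*
  compactness of the dual ball, a weak* open set containing \<open>F\<close> contains every \<open>g\<close> in the dual
  sphere with \<open>g x\<close> close to \<open>1\<close>; by the weak Namioka-Phelps property, such \<open>g\<close> are therefore close
  in norm to some \<open>f\<close> in \<open>F\<close>. This applies to a functional \<open>g\<close> norming \<open>x + t y\<close>, uniformly in \<open>y\<close>
  for small \<open>t > 0\<close>. As \<open>Re (f y)\<close> is a lower bound of all difference quotients
  \<open>(norm (x + s y) - 1) / s\<close>, and \<open>Re (g y)\<close> is an upper bound of the one at \<open>t\<close>, the quotient at
  \<open>t\<close> is within \<open>e\<close> of the infimum of all quotients.
\<close>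

section \<open>Norming functionals\<close>

definition sublinear :: "('a::real_vector \<Rightarrow> real) \<Rightarrow> bool" where
  "sublinear p \<longleftrightarrow> (\<forall>x y. p (x + y) \<le> p x + p y) \<and> (\<forall>r>0. \<forall>x. p (r *\<^sub>R x) \<le> r * p x)"

lemma sublinear_add: "sublinear p \<Longrightarrow> p (x + y) \<le> p x + p y"
  by (simp add: sublinear_def)

lemma sublinear_scaleR_le: "sublinear p \<Longrightarrow> 0 < r \<Longrightarrow> p (r *\<^sub>R x) \<le> r * p x"
  by (simp add: sublinear_def)

lemma sublinear_scaleR:
  assumes "sublinear p" "0 < r"
  shows "p (r *\<^sub>R x) = r * p x"
proof (rule antisym)
  have "p ((1 / r) *\<^sub>R (r *\<^sub>R x)) \<le> (1 / r) * p (r *\<^sub>R x)"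
    using assms by (intro sublinear_scaleR_le) auto
  then show "r * p x \<le> p (r *\<^sub>R x)"
    using assms(2) by (simp add: field_simps)
qed (rule sublinear_scaleR_le[OF assms])

lemma sublinear_0:
  assumes "sublinear p"
  shows "p 0 = 0"
  using sublinear_scaleR[OF assms, of 2 0] by simp

lemma sublinear_minus: "sublinear p \<Longrightarrow> - p (- x) \<le> p x"
  using sublinear_add[of p x "- x"] sublinear_0[of p] by simp

lemma sublinear_norm: "sublinear norm"
  by (simp add: sublinear_def norm_triangle_ineq)

text \<open>Serves both for \<open>tilt\<close> and for the lower bound of a chain in Zorn's lemma.
  The index \<open>k\<close> may depend on \<open>x\<close> and \<open>y\<close>, because the two
  infima on the right are taken one after the other.\<close>

lemma sublinear_INF:
  fixes p :: "'i \<Rightarrow> 'a::real_vector \<Rightarrow> real"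
  assumes "I \<noteq> {}"
    and bdd: "\<And>x. bdd_below ((\<lambda>i. p i x) ` I)"
    and add: "\<And>i j x y. i \<in> I \<Longrightarrow> j \<in> I \<Longrightarrow> \<exists>k\<in>I. p k (x + y) \<le> p i x + p j y"
    and scale: "\<And>i r x. i \<in> I \<Longrightarrow> 0 < r \<Longrightarrow> \<exists>k\<in>I. p k (r *\<^sub>R x) \<le> r * p i x"
  shows "sublinear (\<lambda>x. INF i\<in>I. p i x)"
  unfolding sublinear_def
proof (intro conjI allI impI)
  fix x y
  have "(INF i\<in>I. p i (x + y)) - p j y \<le> p i x" if ij: "i \<in> I" "j \<in> I" for i j
  proof -
    obtain k where "k \<in> I" "p k (x + y) \<le> p i x + p j y"
      using add[OF ij, of x y] by blast
    then show ?thesis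
      using cINF_lower[OF bdd, of k "x + y"] by linarith
  qed
  then have "(INF i\<in>I. p i (x + y)) - p j y \<le> (INF i\<in>I. p i x)" if "j \<in> I" for j
    using that \<open>I \<noteq> {}\<close> by (intro cINF_greatest) auto
  then have "(INF i\<in>I. p i (x + y)) - (INF i\<in>I. p i x) \<le> (INF j\<in>I. p j y)"
    using \<open>I \<noteq> {}\<close> by (intro cINF_greatest) (auto simp: algebra_simps)
  then show "(INF i\<in>I. p i (x + y)) \<le> (INF i\<in>I. p i x) + (INF i\<in>I. p i y)"
    by simp
next
  fix r :: real and x
  assume r: "0 < r"
  have "(INF i\<in>I. p i (r *\<^sub>R x)) / r \<le> p i x" if i: "i \<in> I" for i
  proof -
    obtain k where "k \<in> I" "p k (r *\<^sub>R x) \<le> r * p i x"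
      using scale[OF i r, of x] by blast
    then have "(INF i\<in>I. p i (r *\<^sub>R x)) \<le> r * p i x"
      using cINF_lower[OF bdd, of k "r *\<^sub>R x"] by linarith
    then show ?thesis
      using r by (simp add: field_simps)
  qed
  then have "(INF i\<in>I. p i (r *\<^sub>R x)) / r \<le> (INF i\<in>I. p i x)"
    using \<open>I \<noteq> {}\<close> by (intro cINF_greatest) auto
  then show "(INF i\<in>I. p i (r *\<^sub>R x)) \<le> r * (INF i\<in>I. p i x)"
    using r by (simp add: field_simps)
qed

text \<open>
  For sublinear \<open>p\<close>, this is the largest sublinear \<open>q \<le> p\<close> with \<open>q (- y) \<le> - p y\<close>. It is used
  twice: a minimal sublinear functional equals all its tilts and is therefore linear, and every
  linear functional below \<open>tilt norm x\<close> norms \<open>x\<close>.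
\<close>

definition tilt :: "('a::real_vector \<Rightarrow> real) \<Rightarrow> 'a \<Rightarrow> 'a \<Rightarrow> real" where
  "tilt p y x = (INF t\<in>{0..}. p (x + t *\<^sub>R y) - t * p y)"

lemma tilt_bdd_below:
  assumes "sublinear p"
  shows "bdd_below ((\<lambda>t. p (x + t *\<^sub>R y) - t * p y) ` {0..})"
proof (rule bdd_belowI2)
  fix t :: real
  assume "t \<in> {0..}"
  then have "p (t *\<^sub>R y) = t * p y"
    using sublinear_scaleR[OF assms, of t y] sublinear_0[OF assms] by (cases "t = 0") auto
  moreover have "p (t *\<^sub>R y) \<le> p (x + t *\<^sub>R y) + p (- x)"
    using sublinear_add[OF assms, of "x + t *\<^sub>R y" "- x"] by simp
  ultimately show "- p (- x) \<le> p (x + t *\<^sub>R y) - t * p y"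
    by linarith
qed

lemma tilt_le:
  assumes "sublinear p" "0 \<le> t"
  shows "tilt p y x \<le> p (x + t *\<^sub>R y) - t * p y"
  unfolding tilt_def using assms by (intro cINF_lower tilt_bdd_below) auto

text \<open>Parameters \<open>s\<close> for \<open>x\<close> and \<open>t\<close> for
  \<open>z\<close> combine to \<open>s + t\<close> for \<open>x + z\<close>, and scaling by
  \<open>r\<close> turns \<open>t\<close> into \<open>r * t\<close>.\<close>

lemma sublinear_tilt:
  assumes "sublinear p"
  shows "sublinear (tilt p y)"
  unfolding tilt_def[abs_def]
proof (rule sublinear_INF)
  fix x z and s t :: real
  assume "s \<in> {0..}" "t \<in> {0..}"
  moreover have "p (x + z + (s + t) *\<^sub>R y) \<le> p (x + s *\<^sub>R y) + p (z + t *\<^sub>R y)"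
    using sublinear_add[OF assms, of "x + s *\<^sub>R y" "z + t *\<^sub>R y"] by (simp add: algebra_simps)
  ultimately show "\<exists>k\<in>{0..}. p (x + z + k *\<^sub>R y) - k * p y
      \<le> p (x + s *\<^sub>R y) - s * p y + (p (z + t *\<^sub>R y) - t * p y)"
    by (intro bexI[of _ "s + t"]) (auto simp: algebra_simps)
next
  fix x and r t :: real
  assume "t \<in> {0..}" "0 < r"
  moreover from this have "p (r *\<^sub>R x + (r * t) *\<^sub>R y) \<le> r * p (x + t *\<^sub>R y)"
    using sublinear_scaleR_le[OF assms, of r "x + t *\<^sub>R y"] by (simp add: algebra_simps)
  ultimately show "\<exists>k\<in>{0..}. p (r *\<^sub>R x + k *\<^sub>R y) - k * p y \<le> r * (p (x + t *\<^sub>R y) - t * p y)"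
    by (intro bexI[of _ "r * t"]) (auto simp: algebra_simps)
qed (auto intro: tilt_bdd_below[OF assms])

text \<open>Minimality gives \<open>tilt p y = p\<close> for every \<open>y\<close>. The tilt bound
  at \<open>t = 1\<close> then reads \<open>p x \<le> p (x + y) - p y\<close>, which is
  superadditivity.\<close>

lemma linear_of_minimal_sublinear:
  assumes p: "sublinear p"
    and min: "\<And>q. sublinear q \<Longrightarrow> q \<le> p \<Longrightarrow> q = p"
  shows "linear p"
proof -
  have "tilt p y = p" for y
  proof (rule min[OF sublinear_tilt[OF p]])
    show "tilt p y \<le> p"
      using tilt_le[OF p, of 0 y] by (simp add: le_fun_def)
  qed
  then have "p x + p y \<le> p (x + y)" for x y
    using tilt_le[OF p, of 1 y x] by simp
  then have add: "p (x + y) = p x + p y" for x y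
    using sublinear_add[OF p, of x y] by (simp add: antisym)
  have minus: "p (- x) = - p x" for x
    using add[of x "- x"] sublinear_0[OF p] by simp
  have "p (r *\<^sub>R x) = r * p x" for r x
  proof (cases r "0 :: real" rule: linorder_cases)
    case less
    then show ?thesis
      using sublinear_scaleR[OF p, of "- r" x] minus[of "r *\<^sub>R x"] by simp
  qed (use sublinear_scaleR[OF p] sublinear_0[OF p] in auto)
  then show ?thesis
    using add by (intro linearI) auto
qed

text \<open>A form of the Hahn-Banach theorem: Zorn's lemma provides a minimal sublinear functional
  below \<open>q\<close>. The order is reversed, so the upper bound of a chain is its pointwise
  infimum.\<close>

lemma linear_below_sublinear:
  assumes q: "sublinear q"
  obtains f where "linear f" "f \<le> q"
proof -
  define A where "A = {p. sublinear p \<and> p \<le> q}"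
  have "\<exists>m\<in>A. \<forall>p\<in>A. p \<le> m \<longrightarrow> p = m"
  proof (rule predicate_Zorn)
    show "partial_order_on A (relation_of (\<lambda>p p'. p' \<le> p) A)"
      by (rule partial_order_on_relation_ofI) auto
  next
    fix C
    assume C: "C \<in> Chains (relation_of (\<lambda>p p'. p' \<le> p) A)"
    then have CA: "C \<subseteq> A"
      by (rule Chains_relation_of)
    show "\<exists>u\<in>A. \<forall>p\<in>C. u \<le> p"
    proof (cases "C = {}")
      case True
      then show ?thesis
        using q by (auto simp: A_def)
    next
      case False
      define u where "u = (\<lambda>x. INF p\<in>C. p x)"
      have bdd: "bdd_below ((\<lambda>p. p x) ` C)" for x
      proof (rule bdd_belowI2)
        fix p
        assume "p \<in> C"
        then have "sublinear p" "p (- x) \<le> q (- x)"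
          using CA by (auto simp: A_def le_fun_def)
        then show "- q (- x) \<le> p x"
          using sublinear_minus[of p x] by linarith
      qed
      have "sublinear u"
        unfolding u_def
      proof (rule sublinear_INF[OF False bdd])
        fix p p' and x y :: 'a
        assume p: "p \<in> C" "p' \<in> C"
        then have "p \<le> p' \<or> p' \<le> p"
          using C by (auto simp: Chains_def relation_of_def)
        moreover have "sublinear p" "sublinear p'"
          using p CA by (auto simp: A_def)
        \<comment> \<open>The smaller of the two comparable functionals serves as
          \<open>k\<close>.\<close>
        ultimately show "\<exists>k\<in>C. k (x + y) \<le> p x + p' y"
          using p sublinear_add[of p x y] sublinear_add[of p' x y]
          by (smt (verit, best) le_funD)
      next
        fix p and r :: real and x :: 'a
        assume "p \<in> C" "0 < r"
        then show "\<exists>k\<in>C. k (r *\<^sub>R x) \<le> r * p x"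
          using CA by (intro bexI[of _ p] sublinear_scaleR_le) (auto simp: A_def)
      qed
      moreover have lower: "u \<le> p" if "p \<in> C" for p
        unfolding u_def using that by (intro le_funI cINF_lower bdd) auto
      moreover obtain p where "p \<in> C" "p \<le> q"
        using False CA by (auto simp: A_def)
      then have "u \<le> q"
        using lower order_trans by blast
      ultimately show ?thesis
        by (auto simp: A_def)
    qed
  qed
  then obtain m where m: "m \<in> A" "\<And>p. p \<in> A \<Longrightarrow> p \<le> m \<Longrightarrow> p = m"
    by blast
  have "linear m"
  proof (rule linear_of_minimal_sublinear)
    fix p
    assume "sublinear p" "p \<le> m"
    then show "p = m"
      using m by (intro m(2)) (auto simp: A_def intro: order_trans)
  qed (use m in \<open>auto simp: A_def\<close>)
  with m that show ?thesis
    by (auto simp: A_def)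
qed

section \<open>Norming functionals over real and complex scalars\<close>

lemma norming_real_linear:
  fixes x :: "'a::real_normed_vector"
  obtains f :: "'a \<Rightarrow> real" where "linear f" "f x = norm x" "\<And>z. \<bar>f z\<bar> \<le> norm z"
proof -
  obtain f :: "'a \<Rightarrow> real" where f: "linear f" "f \<le> tilt norm x"
    using linear_below_sublinear[OF sublinear_tilt[OF sublinear_norm]] by blast
  have le: "f z \<le> norm z" for z
    using tilt_le[OF sublinear_norm, of 0 x z] le_funD[OF f(2), of z] by simp
  \<comment> \<open>The tilt bound at \<open>t = 1\<close>, where \<open>- x + x\<close>
    vanishes.\<close>
  have "f (- x) \<le> - norm x"
    using tilt_le[OF sublinear_norm, of 1 x "- x"] le_funD[OF f(2), of "- x"] by simp
  then have "f x = norm x"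
    using le[of x] linear_neg[OF f(1)] by simp
  moreover have "\<bar>f z\<bar> \<le> norm z" for z
    using le[of z] le[of "- z"] linear_neg[OF f(1)] by simp
  ultimately show ?thesis
    using f(1) that by blast
qed

lemma Blinfun_in_dual_sphere:
  fixes h :: "'a::real_normed_vector \<Rightarrow> 'k::real_normed_field"
  assumes sp: "normed_space_over smul"
    and h: "Vector_Spaces.linear smul (*) h"
    and bound: "\<And>z. norm (h z) \<le> norm z"
    and attained: "norm (h x) = norm x" "x \<noteq> 0"
  shows "blinfun_apply (Blinfun h) = h" "Blinfun h \<in> dual_sphere smul"
proof -
  have "h (r *\<^sub>R z) = r *\<^sub>R h z" for r z
    using h normed_space_over.smul_of_real[OF sp, of r z]
    by (metis Vector_Spaces.linear_iff scaleR_conv_of_real)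
  moreover have "h (y + z) = h y + h z" for y z
    using h by (simp add: Vector_Spaces.linear_iff)
  ultimately have "bounded_linear h"
    using bound by (intro bounded_linear_intro[of _ 1]) auto
  then show eq: "blinfun_apply (Blinfun h) = h"
    by (rule bounded_linear_Blinfun_apply)
  have "norm (Blinfun h) = 1"
    using attained bound by (intro norm_blinfun_eqI[of _ _ x]) (auto simp: eq)
  then show "Blinfun h \<in> dual_sphere smul"
    using h by (simp add: dual_sphere_def dual_space_def eq)
qed

lemma norming_functional_real:
  fixes x :: "'a::real_normed_vector"
  assumes "x \<noteq> 0"
  shows "\<exists>f\<in>dual_sphere ((*\<^sub>R) :: real \<Rightarrow> 'a \<Rightarrow> 'a). blinfun_apply f x = of_real (norm x)"
proof -
  obtain f :: "'a \<Rightarrow> real" where f: "linear f" "f x = norm x" "\<And>z. \<bar>f z\<bar> \<le> norm z"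
    using norming_real_linear[of x] by blast
  have "Vector_Spaces.linear (*\<^sub>R) (*) f"
    using f(1) by (simp add: linear_def real_scaleR_def[abs_def])
  then show ?thesis
    using Blinfun_in_dual_sphere[OF normed_space_over_scaleR, of f x] f assms
    by (intro bexI[of _ "Blinfun f"]) auto
qed

lemma norming_functional_complex:
  fixes x :: "'a::real_normed_vector" and scaleC :: "complex \<Rightarrow> 'a \<Rightarrow> 'a"
  assumes sp: "normed_space_over scaleC" and "x \<noteq> 0"
  shows "\<exists>f\<in>dual_sphere scaleC. blinfun_apply f x = of_real (norm x)"
proof -
  interpret normed_space_over scaleC by (fact sp)
  obtain u :: "'a \<Rightarrow> real" where u: "linear u" "u x = norm x" "\<And>z. \<bar>u z\<bar> \<le> norm z"
    using norming_real_linear[of x] by blast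
  \<comment> \<open>The only possible complex-linear \<open>h\<close> with real part
    \<open>u\<close>: its imaginary part is forced by
    \<open>Re (h (scaleC \<i> z)) = - Im (h z)\<close>.\<close>
  define h where "h z = Complex (u z) (- u (scaleC \<i> z))" for z
  have scaleC_eq: "scaleC c z = Re c *\<^sub>R z + Im c *\<^sub>R scaleC \<i> z" for c z
  proof -
    have "scaleC c z = scaleC (of_real (Re c) + of_real (Im c) * \<i>) z"
      by (simp add: complex_eq mult.commute)
    also have "\<dots> = Re c *\<^sub>R z + Im c *\<^sub>R scaleC \<i> z"
      unfolding scale_left_distrib by (simp add: smul_of_real flip: scale_scale)
    finally show ?thesis .
  qed
  have u_scaleC: "u (scaleC c z) = Re c * u z + Im c * u (scaleC \<i> z)" for c z
    by (subst scaleC_eq) (simp add: linear_add[OF u(1)] linear_cmul[OF u(1)])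
  have h_scaleC: "h (scaleC c z) = c * h z" for c z
    using u_scaleC[of c z] u_scaleC[of "\<i> * c" z]
    by (simp add: h_def complex_eq_iff algebra_simps)
  have "h (y + z) = h y + h z" for y z
    by (simp add: h_def complex_eq_iff linear_add[OF u(1)] scale_right_distrib)
  then have h: "Vector_Spaces.linear scaleC (*) h"
    using h_scaleC normed_space_over_times[where 'k = complex] vector_space_axioms
    by (simp add: Vector_Spaces.linear_iff normed_space_over_def)
  have bound: "norm (h z) \<le> norm z" for z
  proof -
    \<comment> \<open>Multiplication by \<open>c\<close> rotates \<open>h z\<close> onto its
      modulus, so that the bound on the real part \<open>u\<close> applies. If
      \<open>h z = 0\<close>, then \<open>c = 0\<close>, hence only
      \<open>norm c \<le> 1\<close>.\<close>
    define c where "c = cnj (sgn (h z))"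
    have "norm c \<le> 1"
      by (simp add: c_def norm_sgn)
    have "norm (h z) = Re (c * h z)"
    proof -
      have "c * h z = h z * cnj (h z) / of_real (norm (h z))"
        by (simp add: c_def sgn_eq)
      then show ?thesis
        unfolding complex_norm_square[symmetric] by (simp add: power2_eq_square)
    qed
    also have "\<dots> = u (scaleC c z)"
      unfolding h_scaleC[symmetric] by (simp add: h_def)
    also have "\<dots> \<le> norm c * norm z"
      using u(3)[of "scaleC c z"] by (simp add: norm_smul)
    also have "\<dots> \<le> norm z"
      using \<open>norm c \<le> 1\<close> by (simp add: mult_left_le_one_le)
    finally show ?thesis .
  qed
  have "h x = of_real (norm x)"
  proof -
    \<comment> \<open>The real part of \<open>h x\<close> already has the largest modulus allowed
      for \<open>h x\<close>, so the imaginary part vanishes.\<close>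
    have "(norm x)\<^sup>2 + (Im (h x))\<^sup>2 \<le> (norm x)\<^sup>2"
      using power_mono[OF bound[of x], of 2] u(2) by (simp add: cmod_power2 h_def)
    then show ?thesis
      using u(2) by (simp add: complex_eq_iff h_def)
  qed
  then show ?thesis
    using Blinfun_in_dual_sphere[OF sp h bound, of x] assms(2)
    by (intro bexI[of _ "Blinfun h"]) auto
qed

section \<open>Compactness of the dual ball\<close>

text \<open>Banach-Alaoglu: a product of closed balls of the scalar field is compact by Tychonoff's
  theorem, and linearity is a closed condition under pointwise convergence. Plain functions are used
  because the weak* topology is pulled back from them.\<close>

lemma compact_dual_ball:
  fixes smul :: "'k::{real_normed_field, heine_borel} \<Rightarrow> 'a::real_normed_vector \<Rightarrow> 'a"
  shows "compact {h. (\<forall>z. norm (h z) \<le> norm z) \<and> Vector_Spaces.linear smul (*) h}"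
proof (cases "vector_space smul")
  \<comment> \<open>\<open>Vector_Spaces.linear\<close> includes the vector space axioms for
    \<open>smul\<close>, so here the set is empty.\<close>
  case False
  then show ?thesis
    by (simp add: Vector_Spaces.linear_iff)
next
  case True
  have times: "vector_space ((*) :: 'k \<Rightarrow> 'k \<Rightarrow> 'k)"
    using normed_space_over_times by (auto simp: normed_space_over_def)
  have "compactin (product_topology (\<lambda>_. euclidean) UNIV) (PiE UNIV (\<lambda>z::'a. cball (0::'k) (norm z)))"
    by (simp add: compactin_PiE)
  then have "compact (PiE UNIV (\<lambda>z::'a. cball (0::'k) (norm z)))"
    by (simp add: euclidean_product_topology)
  moreover have "closed ((\<Inter>y z. {h :: 'a \<Rightarrow> 'k. h (y + z) = h y + h z}) \<inter>
      (\<Inter>c z. {h. h (smul c z) = c * h z}))"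
    by (intro closed_Int closed_INT ballI closed_Collect_eq continuous_intros
        continuous_on_product_coordinates)
  ultimately have "compact (PiE UNIV (\<lambda>z::'a. cball (0::'k) (norm z)) \<inter>
      ((\<Inter>y z. {h :: 'a \<Rightarrow> 'k. h (y + z) = h y + h z}) \<inter> (\<Inter>c z. {h. h (smul c z) = c * h z})))"
    by (rule compact_Int_closed)
  also have "\<dots> = {h. (\<forall>z. norm (h z) \<le> norm z) \<and> Vector_Spaces.linear smul (*) h}"
    using True times by (auto simp: Vector_Spaces.linear_iff PiE_UNIV_domain)
  finally show ?thesis .
qed

section \<open>Strong subdifferentiability\<close>

text \<open>Restates continuity at \<open>f\<close> with an open set of plain functions, which can
  be removed from the compact dual ball.\<close>

lemma weak_namioka_phelps_neighbourhood:
  fixes smul :: "'k::real_normed_field \<Rightarrow> 'a::real_normed_vector \<Rightarrow> 'a"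
  assumes "weak_namioka_phelps smul" "f \<in> dual_sphere smul" "norm_attaining f" "0 < e"
  obtains U where "open U" "blinfun_apply f \<in> U"
    "\<And>g. g \<in> dual_sphere smul \<Longrightarrow> blinfun_apply g \<in> U \<Longrightarrow> norm (g - f) < e"
proof -
  have "topcontinuous_at (subtopology (weak_star_topology smul) (dual_sphere smul))
      (top_of_set (dual_sphere smul)) (\<lambda>g. g) f"
    using assms by (simp add: weak_namioka_phelps_def)
  moreover have "openin (top_of_set (dual_sphere smul)) (dual_sphere smul \<inter> ball f e)"
    by auto
  moreover have "f \<in> dual_sphere smul \<inter> ball f e"
    using assms by simp
  ultimately obtain W where W:
      "openin (subtopology (weak_star_topology smul) (dual_sphere smul)) W" "f \<in> W"
      "W \<subseteq> ball f e"
    unfolding topcontinuous_at_def by (meson Int_iff subsetI)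
  then obtain U where U: "open U" "W = blinfun_apply -` U \<inter> dual_space smul \<inter> dual_sphere smul"
    by (auto simp: openin_subtopology weak_star_topology_def openin_pullback_topology)
  show ?thesis
  proof
    show "norm (g - f) < e" if "g \<in> dual_sphere smul" "blinfun_apply g \<in> U" for g
      using that U(2) W(3) by (auto simp: dual_sphere_def dist_norm norm_minus_commute)
  qed (use U W(2) in auto)
qed

lemma weak_namioka_phelps_near_face:
  fixes smul :: "'k::{real_normed_field, heine_borel} \<Rightarrow> 'a::real_normed_vector \<Rightarrow> 'a"
  assumes sp: "normed_space_over smul" and wnp: "weak_namioka_phelps smul"
    and x: "norm x = 1" and e: "0 < e"
  obtains d where "0 < d"
    "\<And>g. g \<in> dual_sphere smul \<Longrightarrow> norm (blinfun_apply g x - 1) < d \<Longrightarrow>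
       \<exists>f\<in>dual_sphere smul. blinfun_apply f x = 1 \<and> norm (g - f) < e"
proof -
  define F where "F = {f \<in> dual_sphere smul. blinfun_apply f x = 1}"
  have "\<forall>f\<in>F. \<exists>U. open U \<and> blinfun_apply f \<in> U \<and>
      (\<forall>g\<in>dual_sphere smul. blinfun_apply g \<in> U \<longrightarrow> norm (g - f) < e)"
  proof
    fix f
    assume "f \<in> F"
    then have "f \<in> dual_sphere smul" "norm_attaining f"
      using x by (auto simp: F_def norm_attaining_def)
    then show "\<exists>U. open U \<and> blinfun_apply f \<in> U \<and>
        (\<forall>g\<in>dual_sphere smul. blinfun_apply g \<in> U \<longrightarrow> norm (g - f) < e)"
      using weak_namioka_phelps_neighbourhood[OF wnp _ _ e] by metis
  qed
  then obtain U where U: "\<And>f. f \<in> F \<Longrightarrow> open (U f)" "\<And>f. f \<in> F \<Longrightarrow> blinfun_apply f \<in> U f"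
    "\<And>f g. f \<in> F \<Longrightarrow> g \<in> dual_sphere smul \<Longrightarrow> blinfun_apply g \<in> U f \<Longrightarrow> norm (g - f) < e"
    by metis
  \<comment> \<open>The whole ball is used, since it is the compact set at hand; \<open>K\<close> is
    what remains of it outside the neighbourhoods of the face \<open>F\<close>.\<close>
  define K where "K = {h. (\<forall>z. norm (h z) \<le> norm z) \<and> Vector_Spaces.linear smul (*) h} - (\<Union>f\<in>F. U f)"
  have "compact K"
    unfolding K_def using U(1) by (intro compact_diff compact_dual_ball) auto
  \<comment> \<open>A member of the ball with \<open>h x = 1\<close> has norm one, as
    \<open>norm x = 1\<close>. It thus lies in \<open>F\<close>, which the sets \<open>U f\<close>
    cover.\<close>
  have nz: "h x \<noteq> 1" if "h \<in> K" for h
  proof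
    assume "h x = 1"
    moreover have "blinfun_apply (Blinfun h) = h" "Blinfun h \<in> dual_sphere smul"
      using Blinfun_in_dual_sphere[OF sp, of h x] that x \<open>h x = 1\<close> by (force simp: K_def)+
    ultimately have "Blinfun h \<in> F"
      by (simp add: F_def)
    then show False
      using U(2)[of "Blinfun h"] that \<open>blinfun_apply (Blinfun h) = h\<close> by (auto simp: K_def)
  qed
  \<comment> \<open>The distance of \<open>h x\<close> from \<open>1\<close> is continuous in
    \<open>h\<close> and positive on the compact \<open>K\<close>; its minimum is
    \<open>d\<close>.\<close>
  obtain d where d: "0 < d" "\<And>h. h \<in> K \<Longrightarrow> d \<le> norm (h x - 1)"
  proof (cases "K = {}")
    case True
    then show ?thesis
      using that[of 1] by simp
  next
    case False
    have "continuous_on K (\<lambda>h. norm (h x - 1))"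
      by (intro continuous_intros continuous_on_subset[OF continuous_on_product_coordinates]) auto
    then obtain h where "h \<in> K" "\<And>h'. h' \<in> K \<Longrightarrow> norm (h x - 1) \<le> norm (h' x - 1)"
      using continuous_attains_inf[OF \<open>compact K\<close> False] by blast
    then show ?thesis
      using that[of "norm (h x - 1)"] nz by simp
  qed
  show ?thesis
  proof (rule that[OF d(1)])
    fix g
    assume g: "g \<in> dual_sphere smul" "norm (blinfun_apply g x - 1) < d"
    have "norm (blinfun_apply g z) \<le> norm z" for z
      using norm_blinfun[of g z] g(1) by (simp add: dual_sphere_def)
    moreover have "blinfun_apply g \<notin> K"
      using d(2)[of "blinfun_apply g"] g(2) by auto
    ultimately obtain f where "f \<in> F" "blinfun_apply g \<in> U f"
      using g(1) by (auto simp: K_def dual_sphere_def dual_space_def)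
    then show "\<exists>f\<in>dual_sphere smul. blinfun_apply f x = 1 \<and> norm (g - f) < e"
      using U(3) g(1) by (auto simp: F_def)
  qed
qed

text \<open>The limit is the infimum over \<open>s > 0\<close>, finite since every quotient is at
  least \<open>- norm y\<close>. The hypothesis puts the quotient at small \<open>t\<close> within
  \<open>e\<close> of it, uniformly on the unit ball.\<close>

lemma strongly_subdifferentiable_atI:
  assumes "\<And>e. 0 < e \<Longrightarrow> \<exists>d>0. \<forall>t y. 0 < t \<and> t < d \<and> norm y \<le> 1 \<longrightarrow>
      (\<forall>s>0. (norm (x + t *\<^sub>R y) - norm x) / t \<le> (norm (x + s *\<^sub>R y) - norm x) / s + e)"
  shows "strongly_subdifferentiable_at x"
proof -
  define q where "q t y = (norm (x + t *\<^sub>R y) - norm x) / t" for t y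
  define l where "l y = (INF s\<in>{0<..}. q s y)" for y
  have "- norm y \<le> q s y" if "0 < s" for s y
    using norm_triangle_ineq2[of x "- (s *\<^sub>R y)"] that by (simp add: q_def field_simps)
  then have bdd: "bdd_below ((\<lambda>s. q s y) ` {0<..})" for y
    by (intro bdd_belowI2[of _ "- norm y"]) auto
  have "uniform_limit (cball 0 1) q l (at_right 0)"
  proof (rule uniform_limitI)
    fix e :: real
    assume "0 < e"
    \<comment> \<open>Passing to the infimum gives a non-strict bound; \<open>e / 2\<close> makes it
      strict.\<close>
    then obtain d where d: "0 < d" "\<And>t y s. 0 < t \<Longrightarrow> t < d \<Longrightarrow> norm y \<le> 1 \<Longrightarrow> 0 < s \<Longrightarrow>
        q t y \<le> q s y + e / 2"
      using assms[of "e / 2"] by (auto simp: q_def)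
    have "dist (q t y) (l y) < e" if "0 < t" "t < d" "norm y \<le> 1" for t y
    proof -
      have "l y \<le> q t y"
        unfolding l_def using that bdd by (intro cINF_lower) auto
      moreover have "q t y - e / 2 \<le> l y"
        unfolding l_def using d(2)[OF that] by (intro cINF_greatest) (auto simp: algebra_simps)
      ultimately show ?thesis
        using \<open>0 < e\<close> by (simp add: dist_real_def)
    qed
    then show "\<forall>\<^sub>F t in at_right 0. \<forall>y\<in>cball 0 1. dist (q t y) (l y) < e"
      using d(1) by (auto simp: eventually_at_right_field)
  qed
  then show ?thesis
    by (auto simp: strongly_subdifferentiable_at_def q_def[abs_def])
qed

text \<open>
  For \<open>z\<close> in the scalar field, \<open>inner 1 z\<close> is the real part of \<open>z\<close>.
\<close>

lemma strongly_subdifferentiable_at_if_weak_namioka_phelps: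
  fixes smul :: "'k::{real_normed_field, euclidean_space} \<Rightarrow> 'a::real_normed_vector \<Rightarrow> 'a"
  assumes sp: "normed_space_over smul" and wnp: "weak_namioka_phelps smul"
    and norming: "\<And>z. z \<noteq> 0 \<Longrightarrow> \<exists>f\<in>dual_sphere smul. blinfun_apply f z = of_real (norm z)"
    and x: "norm (x :: 'a) = 1"
  shows "strongly_subdifferentiable_at x"
proof (rule strongly_subdifferentiable_atI)
  fix e :: real
  assume e: "0 < e"
  have inner_one_le: "inner 1 z \<le> norm z" for z :: 'k
    using norm_cauchy_schwarz[of 1 z] by simp
  have inner_one_of_real: "inner 1 (of_real r :: 'k) = r" for r
    by (simp add: of_real_def flip: power2_norm_eq_inner)
  have bound: "norm (blinfun_apply g z) \<le> norm z" if "g \<in> dual_sphere smul" for g z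
    using norm_blinfun[of g z] that by (simp add: dual_sphere_def)
  obtain d where d: "0 < d"
    "\<And>g. g \<in> dual_sphere smul \<Longrightarrow> norm (blinfun_apply g x - 1) < d \<Longrightarrow>
       \<exists>f\<in>dual_sphere smul. blinfun_apply f x = 1 \<and> norm (g - f) < e"
    using weak_namioka_phelps_near_face[OF sp wnp x e] by blast
  show "\<exists>d>0. \<forall>t y. 0 < t \<and> t < d \<and> norm y \<le> 1 \<longrightarrow>
      (\<forall>s>0. (norm (x + t *\<^sub>R y) - norm x) / t \<le> (norm (x + s *\<^sub>R y) - norm x) / s + e)"
  \<comment> \<open>The bound \<open>d / 2\<close> suits the estimate
    \<open>norm (g x - 1) \<le> 2 * t\<close> below, and \<open>t < 1\<close> keeps
    \<open>x + t *\<^sub>R y\<close> away from \<open>0\<close>.\<close>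
  proof (intro exI[of _ "min (d / 2) 1"] conjI allI impI)
    fix t s :: real and y :: 'a
    assume "0 < t \<and> t < min (d / 2) 1 \<and> norm y \<le> 1" and s: "0 < s"
    then have t: "0 < t" "t < d / 2" "t < 1" and y: "norm y \<le> 1"
      by auto
    have ty: "norm (t *\<^sub>R y) \<le> t"
      using t y by (simp add: mult_left_le)
    have "x + t *\<^sub>R y \<noteq> 0"
      using ty t x by (metis add_eq_0_iff norm_minus_cancel not_le)
    then obtain g where g: "g \<in> dual_sphere smul"
      "blinfun_apply g (x + t *\<^sub>R y) = of_real (norm (x + t *\<^sub>R y))"
      using norming by blast
    have gx: "blinfun_apply g x + t *\<^sub>R blinfun_apply g y = of_real (norm (x + t *\<^sub>R y))"
      using g(2) by (simp add: blinfun.add_right blinfun.scaleR_right)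
    have "blinfun_apply g x - 1 = of_real (norm (x + t *\<^sub>R y) - 1) - blinfun_apply g (t *\<^sub>R y)"
      using gx by (simp add: blinfun.scaleR_right algebra_simps)
    also have "norm \<dots> \<le> norm (of_real (norm (x + t *\<^sub>R y) - 1) :: 'k) + norm (blinfun_apply g (t *\<^sub>R y))"
      by (rule norm_triangle_ineq4)
    also have "\<dots> \<le> t + t"
    proof (rule add_mono)
      show "norm (of_real (norm (x + t *\<^sub>R y) - 1) :: 'k) \<le> t"
        using norm_triangle_ineq3[of "x + t *\<^sub>R y" x] ty x by (simp del: of_real_diff)
      show "norm (blinfun_apply g (t *\<^sub>R y)) \<le> t"
        using bound[OF g(1), of "t *\<^sub>R y"] ty by linarith
    qed
    finally obtain f where f: "f \<in> dual_sphere smul" "blinfun_apply f x = 1" "norm (g - f) < e"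
      using d(2)[OF g(1)] t by auto
    \<comment> \<open>Real parts of the norming identity for \<open>g\<close>; as that of
      \<open>g x\<close> is at most \<open>1\<close>, that of \<open>g y\<close> dominates the
      quotient at \<open>t\<close>.\<close>
    have "norm (x + t *\<^sub>R y) = inner 1 (blinfun_apply g x) + t * inner 1 (blinfun_apply g y)"
      using arg_cong[OF gx, of "inner 1"] by (simp add: inner_add_right inner_one_of_real)
    also have "inner 1 (blinfun_apply g x) \<le> 1"
      using inner_one_le[of "blinfun_apply g x"] bound[OF g(1), of x] x by linarith
    finally have "(norm (x + t *\<^sub>R y) - norm x) / t \<le> inner 1 (blinfun_apply g y)"
      using t x by (simp add: field_simps)
    also have "\<dots> = inner 1 (blinfun_apply f y) + inner 1 (blinfun_apply (g - f) y)"
      by (simp add: blinfun.diff_left inner_diff_right)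
    also have "inner 1 (blinfun_apply (g - f) y) \<le> e"
    proof -
      have "inner 1 (blinfun_apply (g - f) y) \<le> norm (g - f) * norm y"
        using inner_one_le norm_blinfun order_trans by blast
      also have "\<dots> \<le> e * 1"
        using f(3) y e by (intro mult_mono) auto
      finally show ?thesis by simp
    qed
    \<comment> \<open>The real part of \<open>f\<close> is a subgradient of the norm at
      \<open>x\<close>, since \<open>f x = 1\<close> and \<open>f\<close> has norm one.\<close>
    also have "inner 1 (blinfun_apply f y) \<le> (norm (x + s *\<^sub>R y) - norm x) / s"
    proof -
      have "1 + s * inner 1 (blinfun_apply f y) = inner 1 (blinfun_apply f (x + s *\<^sub>R y))"
        using inner_one_of_real[of 1]
        by (simp add: blinfun.add_right blinfun.scaleR_right inner_add_right f(2))
      also have "\<dots> \<le> norm (x + s *\<^sub>R y)"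
        using inner_one_le bound[OF f(1)] order_trans by blast
      finally show ?thesis
        using s x by (simp add: field_simps)
    qed
    finally show "(norm (x + t *\<^sub>R y) - norm x) / t \<le> (norm (x + s *\<^sub>R y) - norm x) / s + e"
      by simp
  qed (use d in auto)
qed

theorem theorem1:
  shows "(weak_namioka_phelps ((*\<^sub>R) :: real \<Rightarrow> 'a::banach \<Rightarrow> 'a) \<longrightarrow>
           (\<forall>x::'a. norm x = 1 \<longrightarrow> strongly_subdifferentiable_at x)) \<and>
         (\<forall>scaleC :: complex \<Rightarrow> 'b::banach \<Rightarrow> 'b.
           normed_space_over scaleC \<and> weak_namioka_phelps scaleC \<longrightarrow>
           (\<forall>x::'b. norm x = 1 \<longrightarrow> strongly_subdifferentiable_at x))"
  using strongly_subdifferentiable_at_if_weak_namioka_phelps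
      [OF normed_space_over_scaleR _ norming_functional_real]
    strongly_subdifferentiable_at_if_weak_namioka_phelps[OF _ _ norming_functional_complex]
  by blast

end
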